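(* A Kripke frame $(X,T,S)$ is an $\mathsf{MS^2IC}$-frame if and only if for all $x,y,z,w\in X$: (1) $Txxx$; (2) $Txyz$ implies $Txzy$; (3) the binary relation $E_T$ defined by $xE_Ty$ iff $\exists z\,Txyz$ is an equivalence relation; (4) $Txyz$ and $xE_Tw$ imply $Twyz$; (5) $Txyz$ and $ySw$ imply that there is $u\in X$ with $Txwu$ and $zSu$. Moreover, $\mathsf{MS^2IC}$ is Kripke complete: a formula is a theorem of $\mathsf{MS^2IC}$ iff it is valid in all $\mathsf{MS^2IC}$-frames.
   Context: Language: propositional variables, $\top,\bot$, $\neg,\wedge,\vee,\to,\leftrightarrow$, a binary connective $\rightsquigarrow$ and a unary modality $\Box$; $\Diamond\phi:=\neg\Box\neg\phi$, $[\forall]\phi:=\top\rightsquigarrow\phi$. $\mathsf{MS^2IC}$: theorems are the least set containing all instances of classical tautologies and of (A1) $(\bot\rightsquigarrow\phi)\wedge(\phi\rightsquigarrow\top)$; (A2) $((\phi\vee\psi)\rightsquigarrow\chi)\leftrightarrow((\phi\rightsquigarrow\chi)\wedge(\psi\rightsquigarrow\chi))$; (A3) $(\phi\rightsquigarrow(\psi\wedge\chi))\leftrightarrow((\phi\rightsquigarrow\psi)\wedge(\phi\rightsquigarrow\chi))$; (A4) $(\phi\rightsquigarrow\psi)\to(\phi\to\psi)$; (A5) $(\phi\rightsquigarrow\psi)\leftrightarrow(\neg\psi\rightsquigarrow\neg\phi)$; (A8) $[\forall]\phi\to[\forall][\forall]\phi$; (A9) $\neg[\forall]\phi\to[\forall]\neg[\forall]\phi$;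 (A10) $(\phi\rightsquigarrow\psi)\leftrightarrow[\forall](\phi\rightsquigarrow\psi)$; (A11) $[\forall]\phi\to(\neg[\forall]\phi\rightsquigarrow\bot)$; (K) $\Box(\phi\to\psi)\to(\Box\phi\to\Box\psi)$; (Add) $(\phi\rightsquigarrow\psi)\to(\Box\phi\rightsquigarrow\Box\psi)$; closed under modus ponens, from $\phi$ infer $[\forall]\phi$, from $\phi$ infer $\Box\phi$. A Kripke frame is $(X,T,S)$ with $T$ ternary and $S$ binary relations on a set $X$. For a valuation $v$ (variables to subsets of $X$), Boolean connectives are interpreted classically, $x\vDash_v\phi\rightsquigarrow\psi$ iff for all $y,z$ ($Txyz$ and $y\vDash_v\phi$ imply $z\vDash_v\psi$), and $x\vDash_v\Diamond\phi$ iff there is $y$ with $xSy$ and $y\vDash_v\phi$ (so $x\vDash_v\Box\phi$ iff all $S$-successors satisfy $\phi$). $\phi$ is valid in the frame if it holds at every point under every valuation. An $\mathsf{MS^2IC}$-frame is a Kripke frame validating all theorems of $\mathsf{MS^2IC}$.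
   Formalization: The calculus has one added rule: from φ↔φ' and ψ↔ψ' infer (φ⇝ψ)↔(φ'⇝ψ'). Without it completeness fails: ((p∧p)⇝q)→(p⇝q) is valid in every Kripke frame but not derivable. The class of MS²IC-frames is unchanged by the rule. *)

theory Defs
  imports Main
begin

datatype fm =
    Var nat
  | Top ("\<^bold>\<top>")
  | Bot ("\<^bold>\<bottom>")
  | Neg fm ("\<^bold>\<not> _" [70] 70)
  | Con fm fm (infixr "\<^bold>\<and>" 65)
  | Dis fm fm (infixr "\<^bold>\<or>" 60)
  | Imp fm fm (infixr "\<^bold>\<rightarrow>" 55)
  | Iff fm fm (infixr "\<^bold>\<leftrightarrow>" 50)
  | Strict fm fm (infix "\<leadsto>" 58)
  | Box fm ("\<^bold>\<box> _" [70] 70)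

abbreviation Univ :: "fm \<Rightarrow> fm" ("\<^bold>[\<^bold>\<forall>\<^bold>] _" [70] 70) where
  "\<^bold>[\<^bold>\<forall>\<^bold>] \<phi> \<equiv> \<^bold>\<top> \<leadsto> \<phi>"

text \<open>
  Truth-functional evaluation: variables and formulas \<open>\<phi> \<leadsto> \<psi>\<close>, \<open>\<^bold>\<box> \<phi>\<close> are treated
  as atoms, with truth values given by \<open>h\<close>.  A formula is a substitution instance of a
  classical tautology iff it is true under all such \<open>h\<close>.
\<close>

primrec bool_eval :: "(fm \<Rightarrow> bool) \<Rightarrow> fm \<Rightarrow> bool" where
  "bool_eval h (Var p) = h (Var p)"
| "bool_eval h \<^bold>\<top> = True"
| "bool_eval h \<^bold>\<bottom> = False"
| "bool_eval h (\<^bold>\<not> \<phi>) = (\<not> bool_eval h \<phi>)"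
| "bool_eval h (\<phi> \<^bold>\<and> \<psi>) = (bool_eval h \<phi> \<and> bool_eval h \<psi>)"
| "bool_eval h (\<phi> \<^bold>\<or> \<psi>) = (bool_eval h \<phi> \<or> bool_eval h \<psi>)"
| "bool_eval h (\<phi> \<^bold>\<rightarrow> \<psi>) = (bool_eval h \<phi> \<longrightarrow> bool_eval h \<psi>)"
| "bool_eval h (\<phi> \<^bold>\<leftrightarrow> \<psi>) = (bool_eval h \<phi> \<longleftrightarrow> bool_eval h \<psi>)"
| "bool_eval h (\<phi> \<leadsto> \<psi>) = h (\<phi> \<leadsto> \<psi>)"
| "bool_eval h (\<^bold>\<box> \<phi>) = h (\<^bold>\<box> \<phi>)"

definition tautology :: "fm \<Rightarrow> bool" where
  "tautology \<phi> \<longleftrightarrow> (\<forall>h. bool_eval h \<phi>)"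

text \<open>
  The rule \<open>RE\<close> (replacement of provable equivalents under \<open>\<leadsto>\<close>) is the usual convention
  for a modal calculus whose Lindenbaum algebra interprets \<open>\<leadsto>\<close>; it is made explicit because
  it does not follow from the other clauses.  Without it, \<open>((p \<and> p) \<leadsto> q) \<rightarrow> (p \<leadsto> q)\<close>
  would not be a theorem although it is valid in every Kripke frame.  To see this, define
  \<open>l, r :: fm \<Rightarrow> bool\<close> by recursion with \<open>l (\<phi> \<or> \<psi>) = (l \<phi> \<or> l \<psi>)\<close>,
  \<open>r (\<phi> \<and> \<psi>) = (r \<phi> \<and> r \<psi>)\<close>, \<open>l (\<not> \<phi>) = (\<not> r \<phi>)\<close>, \<open>r (\<not> \<phi>) = (\<not> l \<phi>)\<close>,
  \<open>l p = True\<close> and \<open>r p = False\<close> for variables \<open>p\<close>, and \<open>l \<phi> = False\<close>, \<open>r \<phi> = True\<close> for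
  all other forms of \<open>\<phi>\<close>.  Let all variables be true, let \<open>\<box> \<phi>\<close> be true iff \<open>\<phi>\<close> is, and let
  \<open>\<phi> \<leadsto> \<psi>\<close> be true iff \<open>\<phi> \<rightarrow> \<psi>\<close> is and \<open>l \<phi> \<longrightarrow> r \<psi>\<close>.  Then all axioms are true and the
  rules other than \<open>RE\<close> preserve truth, but the formula above is false.  In Kripke
  frames \<open>RE\<close> preserves validity, so it does not affect the class of frames.
\<close>

inductive MS2IC :: "fm \<Rightarrow> bool" ("\<turnstile> _" [50] 50) where
  Taut: "tautology \<phi> \<Longrightarrow> \<turnstile> \<phi>"
| A1: "\<turnstile> (\<^bold>\<bottom> \<leadsto> \<phi>) \<^bold>\<and> (\<phi> \<leadsto> \<^bold>\<top>)"
| A2: "\<turnstile> ((\<phi> \<^bold>\<or> \<psi>) \<leadsto> \<chi>) \<^bold>\<leftrightarrow> ((\<phi> \<leadsto> \<chi>) \<^bold>\<and> (\<psi> \<leadsto> \<chi>))"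
| A3: "\<turnstile> (\<phi> \<leadsto> (\<psi> \<^bold>\<and> \<chi>)) \<^bold>\<leftrightarrow> ((\<phi> \<leadsto> \<psi>) \<^bold>\<and> (\<phi> \<leadsto> \<chi>))"
| A4: "\<turnstile> (\<phi> \<leadsto> \<psi>) \<^bold>\<rightarrow> (\<phi> \<^bold>\<rightarrow> \<psi>)"
| A5: "\<turnstile> (\<phi> \<leadsto> \<psi>) \<^bold>\<leftrightarrow> ((\<^bold>\<not> \<psi>) \<leadsto> (\<^bold>\<not> \<phi>))"
| A8: "\<turnstile> (\<^bold>[\<^bold>\<forall>\<^bold>] \<phi>) \<^bold>\<rightarrow> (\<^bold>[\<^bold>\<forall>\<^bold>] (\<^bold>[\<^bold>\<forall>\<^bold>] \<phi>))"
| A9: "\<turnstile> (\<^bold>\<not> (\<^bold>[\<^bold>\<forall>\<^bold>] \<phi>)) \<^bold>\<rightarrow> (\<^bold>[\<^bold>\<forall>\<^bold>] (\<^bold>\<not> (\<^bold>[\<^bold>\<forall>\<^bold>] \<phi>)))"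
| A10: "\<turnstile> (\<phi> \<leadsto> \<psi>) \<^bold>\<leftrightarrow> (\<^bold>[\<^bold>\<forall>\<^bold>] (\<phi> \<leadsto> \<psi>))"
| A11: "\<turnstile> (\<^bold>[\<^bold>\<forall>\<^bold>] \<phi>) \<^bold>\<rightarrow> ((\<^bold>\<not> (\<^bold>[\<^bold>\<forall>\<^bold>] \<phi>)) \<leadsto> \<^bold>\<bottom>)"
| K: "\<turnstile> (\<^bold>\<box> (\<phi> \<^bold>\<rightarrow> \<psi>)) \<^bold>\<rightarrow> ((\<^bold>\<box> \<phi>) \<^bold>\<rightarrow> (\<^bold>\<box> \<psi>))"
| Add: "\<turnstile> (\<phi> \<leadsto> \<psi>) \<^bold>\<rightarrow> ((\<^bold>\<box> \<phi>) \<leadsto> (\<^bold>\<box> \<psi>))"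
| MP: "\<lbrakk>\<turnstile> \<phi> \<^bold>\<rightarrow> \<psi>; \<turnstile> \<phi>\<rbrakk> \<Longrightarrow> \<turnstile> \<psi>"
| N_Univ: "\<turnstile> \<phi> \<Longrightarrow> \<turnstile> (\<^bold>[\<^bold>\<forall>\<^bold>] \<phi>)"
| N_Box: "\<turnstile> \<phi> \<Longrightarrow> \<turnstile> (\<^bold>\<box> \<phi>)"
| RE: "\<lbrakk>\<turnstile> \<phi> \<^bold>\<leftrightarrow> \<phi>'; \<turnstile> \<psi> \<^bold>\<leftrightarrow> \<psi>'\<rbrakk> \<Longrightarrow> \<turnstile> (\<phi> \<leadsto> \<psi>) \<^bold>\<leftrightarrow> (\<phi>' \<leadsto> \<psi>')"

definition kripke_frame ::
  "'w set \<Rightarrow> ('w \<Rightarrow> 'w \<Rightarrow> 'w \<Rightarrow> bool) \<Rightarrow> ('w \<Rightarrow> 'w \<Rightarrow> bool) \<Rightarrow> bool" where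
  "kripke_frame X T S \<longleftrightarrow>
     (\<forall>x y z. T x y z \<longrightarrow> x \<in> X \<and> y \<in> X \<and> z \<in> X) \<and>
     (\<forall>x y. S x y \<longrightarrow> x \<in> X \<and> y \<in> X)"

primrec sat ::
  "'w set \<Rightarrow> ('w \<Rightarrow> 'w \<Rightarrow> 'w \<Rightarrow> bool) \<Rightarrow> ('w \<Rightarrow> 'w \<Rightarrow> bool) \<Rightarrow> (nat \<Rightarrow> 'w set) \<Rightarrow> 'w \<Rightarrow> fm \<Rightarrow> bool"
where
  "sat X T S v x (Var p) = (x \<in> v p)"
| "sat X T S v x \<^bold>\<top> = True"
| "sat X T S v x \<^bold>\<bottom> = False"
| "sat X T S v x (\<^bold>\<not> \<phi>) = (\<not> sat X T S v x \<phi>)"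
| "sat X T S v x (\<phi> \<^bold>\<and> \<psi>) = (sat X T S v x \<phi> \<and> sat X T S v x \<psi>)"
| "sat X T S v x (\<phi> \<^bold>\<or> \<psi>) = (sat X T S v x \<phi> \<or> sat X T S v x \<psi>)"
| "sat X T S v x (\<phi> \<^bold>\<rightarrow> \<psi>) = (sat X T S v x \<phi> \<longrightarrow> sat X T S v x \<psi>)"
| "sat X T S v x (\<phi> \<^bold>\<leftrightarrow> \<psi>) = (sat X T S v x \<phi> \<longleftrightarrow> sat X T S v x \<psi>)"
| "sat X T S v x (\<phi> \<leadsto> \<psi>) =
     (\<forall>y\<in>X. \<forall>z\<in>X. T x y z \<and> sat X T S v y \<phi> \<longrightarrow> sat X T S v z \<psi>)"
| "sat X T S v x (\<^bold>\<box> \<phi>) = (\<forall>y\<in>X. S x y \<longrightarrow> sat X T S v y \<phi>)"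

definition valid_in ::
  "'w set \<Rightarrow> ('w \<Rightarrow> 'w \<Rightarrow> 'w \<Rightarrow> bool) \<Rightarrow> ('w \<Rightarrow> 'w \<Rightarrow> bool) \<Rightarrow> fm \<Rightarrow> bool" where
  "valid_in X T S \<phi> \<longleftrightarrow> (\<forall>v. (\<forall>p. v p \<subseteq> X) \<longrightarrow> (\<forall>x\<in>X. sat X T S v x \<phi>))"

definition MS2IC_frame ::
  "'w set \<Rightarrow> ('w \<Rightarrow> 'w \<Rightarrow> 'w \<Rightarrow> bool) \<Rightarrow> ('w \<Rightarrow> 'w \<Rightarrow> bool) \<Rightarrow> bool" where
  "MS2IC_frame X T S \<longleftrightarrow> kripke_frame X T S \<and> (\<forall>\<phi>. (\<turnstile> \<phi>) \<longrightarrow> valid_in X T S \<phi>)"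

definition E_rel :: "'w set \<Rightarrow> ('w \<Rightarrow> 'w \<Rightarrow> 'w \<Rightarrow> bool) \<Rightarrow> ('w \<times> 'w) set" where
  "E_rel X T = {(x, y). x \<in> X \<and> y \<in> X \<and> (\<exists>z\<in>X. T x y z)}"

text \<open>
  Validity in all \<open>MS2IC\<close>-frames whose points are drawn from the type \<open>'w\<close>; HOL cannot
  quantify over all types inside a formula.  Soundness is to be stated for arbitrary \<open>'w\<close>;
  for completeness it suffices that validity over the single type \<open>fm set\<close> implies
  provability, since this hypothesis is weaker than validity in frames of every type.
\<close>

definition valid_in_all_frames :: "'w itself \<Rightarrow> fm \<Rightarrow> bool" where
  "valid_in_all_frames _ \<phi> \<longleftrightarrow>
     (\<forall>(X :: 'w set) T S. MS2IC_frame X T S \<longrightarrow> valid_in X T S \<phi>)"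

end

theory Submission
  imports Defs
begin

text \<open>
  The frame conditions are read off the axioms with singletons and complements of singletons as
  valuations.  Completeness uses the canonical frame on the maximal consistent sets, where
  \<open>T x y z\<close> means that \<open>\<psi> \<in> z\<close> whenever \<open>\<phi> \<leadsto> \<psi> \<in> x\<close> and \<open>\<phi> \<in> y\<close>.  By (A9) and (A10),
  \<open>E\<^sub>T\<close>-related points contain the same formulas \<open>\<phi> \<leadsto> \<psi>\<close>, so \<open>T x = T y\<close> whenever
  \<open>x E\<^sub>T y\<close>; this yields conditions (3) and (4) at once.  All points whose existence is needed
  are obtained by extending a deductively closed set that omits a given formula.
\<close>

section \<open>Frame correspondence\<close>

definition MS2IC_conditions ::
  "'w set \<Rightarrow> ('w \<Rightarrow> 'w \<Rightarrow> 'w \<Rightarrow> bool) \<Rightarrow> ('w \<Rightarrow> 'w \<Rightarrow> bool) \<Rightarrow> bool" where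
  "MS2IC_conditions X T S \<longleftrightarrow>
     (\<forall>x\<in>X. T x x x) \<and>
     (\<forall>x\<in>X. \<forall>y\<in>X. \<forall>z\<in>X. T x y z \<longrightarrow> T x z y) \<and>
     equiv X (E_rel X T) \<and>
     (\<forall>x\<in>X. \<forall>y\<in>X. \<forall>z\<in>X. \<forall>w\<in>X. T x y z \<and> (x, w) \<in> E_rel X T \<longrightarrow> T w y z) \<and>
     (\<forall>x\<in>X. \<forall>y\<in>X. \<forall>z\<in>X. \<forall>w\<in>X. T x y z \<and> S y w \<longrightarrow> (\<exists>u\<in>X. T x w u \<and> S z u))"

text \<open>Truth at a fixed point is one of the assignments \<open>h\<close> over which
  \<open>tautology\<close> quantifies, so tautologies hold at every point.\<close>

lemma bool_eval_sat: "bool_eval (sat X T S v x) \<phi> = sat X T S v x \<phi>"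
  by (induction \<phi>) auto

text \<open>By (2) both \<open>y\<close> and \<open>z\<close> are related to \<open>x\<close> by
  \<open>E_rel X T\<close>, and symmetry of that relation allows (4) to be used in both directions.
  Hence the truth value of \<phi> \<leadsto> \<psi> is constant along \<open>T\<close>.\<close>

lemma T_eq_if_E:
  assumes "MS2IC_conditions X T S" and "x \<in> X" "y \<in> X" "z \<in> X" "T x y z"
    and "a \<in> X" "b \<in> X"
  shows "T y a b \<longleftrightarrow> T x a b" and "T z a b \<longleftrightarrow> T x a b"
proof -
  have "T x z y"
    using assms unfolding MS2IC_conditions_def by blast
  then have 1: "(x, y) \<in> E_rel X T" "(x, z) \<in> E_rel X T"
    using assms(2-5) by (auto simp: E_rel_def)
  have "sym (E_rel X T)"
    using assms(1) by (simp add: MS2IC_conditions_def equiv_def)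
  with 1 have 2: "(y, x) \<in> E_rel X T" "(z, x) \<in> E_rel X T"
    by (auto dest: symD)
  have *: "T w a b" if "u \<in> X" "w \<in> X" "T u a b" "(u, w) \<in> E_rel X T" for u w
    using assms(1,6,7) that unfolding MS2IC_conditions_def by blast
  show "T y a b \<longleftrightarrow> T x a b" "T z a b \<longleftrightarrow> T x a b"
    using 1 2 * assms(2-4) by blast+
qed

text \<open>Condition (1) yields (A4), (2) yields (A5), constancy of \<open>T\<close> along related
  points yields (A8) to (A11), with (1) again for (A10), and (5) together with (2) yields
  (Add).\<close>

lemma soundness:
  assumes cond: "MS2IC_conditions X T S" and "\<turnstile> \<phi>"
  shows "\<forall>x\<in>X. sat X T S v x \<phi>"
  using assms(2)
proof (induction \<phi> rule: MS2IC.induct)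
  case (Taut \<phi>)
  then have "bool_eval (sat X T S v x) \<phi>" for x by (simp add: tautology_def)
  then show ?case by (simp add: bool_eval_sat)
next
  case (A4 \<phi> \<psi>)
  have "\<And>x. x \<in> X \<Longrightarrow> T x x x"
    using cond by (simp add: MS2IC_conditions_def)
  then show ?case by auto
next
  case (A5 \<phi> \<psi>)
  have "\<And>x y z. x \<in> X \<Longrightarrow> y \<in> X \<Longrightarrow> z \<in> X \<Longrightarrow> T x y z \<longleftrightarrow> T x z y"
    using cond unfolding MS2IC_conditions_def by blast
  then show ?case unfolding sat.simps by blast
next
  case (A8 \<phi>)
  then show ?case unfolding sat.simps using T_eq_if_E[OF cond] by blast
next
  case (A9 \<phi>)
  then show ?case unfolding sat.simps using T_eq_if_E[OF cond] by blast
next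
  case (A10 \<phi> \<psi>)
  have "\<And>x. x \<in> X \<Longrightarrow> T x x x"
    using cond by (simp add: MS2IC_conditions_def)
  moreover have "sat X T S v z (\<phi> \<leadsto> \<psi>) \<longleftrightarrow> sat X T S v x (\<phi> \<leadsto> \<psi>)"
    if "x \<in> X" "y \<in> X" "z \<in> X" "T x y z" for x y z
    unfolding sat.simps using T_eq_if_E(2)[OF cond that] by simp
  \<comment> \<open>Only the outer \<leadsto>, whose antecedent is \<open>Top\<close>, is unfolded.
    The inner formula stays whole, so its constancy along \<open>T\<close> applies directly.\<close>
  ultimately show ?case unfolding sat.simps(2,8) sat.simps(9)[where \<phi> = "\<^bold>\<top>"] by blast
next
  case (A11 \<phi>)
  then show ?case unfolding sat.simps using T_eq_if_E[OF cond] by blast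
next
  case (Add \<phi> \<psi>)
  have "sat X T S v w \<psi>"
    if X: "x \<in> X" "y \<in> X" "z \<in> X" "w \<in> X" and TS: "T x y z" "S z w"
      and "sat X T S v x (\<phi> \<leadsto> \<psi>)" "sat X T S v y (\<^bold>\<box> \<phi>)" for x y z w
  proof -
    have "T x z y"
      using cond X TS unfolding MS2IC_conditions_def by blast
    \<comment> \<open>Condition (5) is applied to the reversed triple: the step from
      \<open>z\<close> to \<open>w\<close> is matched by a step from \<open>y\<close> to
      \<open>u\<close>, and the boxed formula at \<open>y\<close> gives \<phi> at
      \<open>u\<close>.\<close>
    then obtain u where "u \<in> X" "T x w u" "S y u"
      using cond X TS unfolding MS2IC_conditions_def by meson
    moreover from this have "T x u w"
      using cond X unfolding MS2IC_conditions_def by blast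
    ultimately show ?thesis using that by auto
  qed
  then show ?case by auto
next
  case (A2 \<phi> \<psi> \<chi>)
  show ?case unfolding sat.simps by blast
next
  case (A3 \<phi> \<psi> \<chi>)
  show ?case unfolding sat.simps by blast
next
  case (K \<phi> \<psi>)
  show ?case unfolding sat.simps by blast
next
  case (MP \<phi> \<psi>)
  then show ?case unfolding sat.simps by blast
next
  case (N_Univ \<phi>)
  then show ?case unfolding sat.simps by blast
next
  case (N_Box \<phi>)
  then show ?case unfolding sat.simps by blast
next
  case (RE \<phi> \<phi>' \<psi> \<psi>')
  then show ?case unfolding sat.simps by blast
qed simp

section \<open>Necessity of the five frame conditions\<close>

lemma MS2IC_frame_imp_conditions:
  assumes frame: "MS2IC_frame X T S"
  shows "MS2IC_conditions X T S"
proof -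
  \<comment> \<open>Every condition comes from one axiom in \<open>Var 0\<close> and
    \<open>Var 1\<close>: (1) from (A4), (2) from (A5), transitivity from (A8), symmetry of
    \<open>E_rel\<close> from (A9), (4) from (A10), (5) from (Add).\<close>
  have valid: "sat X T S (\<lambda>n. if n = 0 then P else Q) x \<phi>"
    if "\<turnstile> \<phi>" "P \<subseteq> X" "Q \<subseteq> X" "x \<in> X" for \<phi> P Q x
    using frame that unfolding MS2IC_frame_def valid_in_def by simp
  \<comment> \<open>If \<open>T x x x\<close> failed, \<open>Var 0 \<leadsto> Var 1\<close> would
    hold at \<open>x\<close>, while the material implication fails there.\<close>
  have refl: "T x x x" if "x \<in> X" for x
    using valid[OF A4[of "Var 0" "Var 1"], of "{x}" "X - {x}" x] that by auto
  \<comment> \<open>Under this valuation the left side of (A5) holds at \<open>x\<close> iff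
    \<open>T x y z\<close> fails, and the right side iff \<open>T x z y\<close> fails.\<close>
  have sym: "T x z y" if "x \<in> X" "y \<in> X" "z \<in> X" "T x y z" for x y z
    using valid[OF A5[of "Var 0" "Var 1"], of "{y}" "X - {z}" x] that by auto
  have reflE: "(x, x) \<in> E_rel X T" if "x \<in> X" for x
    using refl that by (auto simp: E_rel_def)
  \<comment> \<open>By (2) the third argument of \<open>T\<close> may serve as the second, so
    \<open>Univ\<close> is the Kripke box of \<open>E_rel X T\<close>. Transitivity and symmetry
    then follow as for the modal axioms 4 and 5.\<close>
  have E: "(x, z) \<in> E_rel X T \<longleftrightarrow> x \<in> X \<and> z \<in> X \<and> (\<exists>y\<in>X. T x y z)" for x z
    using sym by (auto simp: E_rel_def)
  have box: "sat X T S v x (\<^bold>[\<^bold>\<forall>\<^bold>] \<phi>) \<longleftrightarrow> (\<forall>z. (x, z) \<in> E_rel X T \<longrightarrow> sat X T S v z \<phi>)"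
    if "x \<in> X" for v x \<phi>
    using that by (auto simp: E)
  have transE: "(x, z) \<in> E_rel X T"
    if xy: "(x, y) \<in> E_rel X T" and yz: "(y, z) \<in> E_rel X T" for x y z
  proof (rule ccontr)
    assume n: "(x, z) \<notin> E_rel X T"
    \<comment> \<open>\<open>Var 0\<close> fails only at \<open>z\<close>, which is assumed not to
      be reached from \<open>x\<close>; (A8) makes it true after two steps, hence at
      \<open>z\<close>.\<close>
    let ?v = "\<lambda>n. if n = 0 then X - {z} else {}"
    have X: "x \<in> X" "y \<in> X" using xy by (auto simp: E_rel_def)
    have "sat X T S ?v x (\<^bold>[\<^bold>\<forall>\<^bold>] (Var 0))"
      unfolding box[OF X(1)] using n by (auto simp: E)
    then have "sat X T S ?v x (\<^bold>[\<^bold>\<forall>\<^bold>] (\<^bold>[\<^bold>\<forall>\<^bold>] (Var 0)))"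
      using valid[OF A8[of "Var 0"], of "X - {z}" "{}" x] X(1) by (simp del: sat.simps(9))
    then have "sat X T S ?v z (Var 0)"
      using xy yz unfolding box[OF X(1)] using box[OF X(2)] by blast
    then show False by simp
  qed
  have symE: "(y, x) \<in> E_rel X T" if xy: "(x, y) \<in> E_rel X T" for x y
  proof (rule ccontr)
    assume n: "(y, x) \<notin> E_rel X T"
    \<comment> \<open>\<open>Var 0\<close> fails only at \<open>x\<close>. Reflexivity makes its
      universal closure false at \<open>x\<close>, (A9) carries this to \<open>y\<close>, but there
      it is true if \<open>x\<close> is not reached from \<open>y\<close>.\<close>
    let ?v = "\<lambda>n. if n = 0 then X - {x} else {}"
    have X: "x \<in> X" "y \<in> X" using xy by (auto simp: E_rel_def)
    have "sat X T S ?v x (\<^bold>\<not> (\<^bold>[\<^bold>\<forall>\<^bold>] (Var 0)))"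
      using refl[OF X(1)] X(1) by auto
    then have "sat X T S ?v x (\<^bold>[\<^bold>\<forall>\<^bold>] (\<^bold>\<not> (\<^bold>[\<^bold>\<forall>\<^bold>] (Var 0))))"
      using valid[OF A9[of "Var 0"], of "X - {x}" "{}" x] X(1) by (simp del: sat.simps(9))
    then have "sat X T S ?v y (\<^bold>\<not> (\<^bold>[\<^bold>\<forall>\<^bold>] (Var 0)))"
      using xy box[OF X(1)] by blast
    moreover have "sat X T S ?v y (\<^bold>[\<^bold>\<forall>\<^bold>] (Var 0))"
      unfolding box[OF X(2)] using n by (auto simp: E_rel_def)
    ultimately show False unfolding sat.simps(4) by blast
  qed
  have equivE: "equiv X (E_rel X T)"
  proof (rule equivI)
    show "E_rel X T \<subseteq> X \<times> X" by (auto simp: E_rel_def)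
    show "refl_on X (E_rel X T)" by (rule refl_onI) (rule reflE)
    show "sym (E_rel X T)" by (rule symI) (rule symE)
    show "trans (E_rel X T)" by (rule transI) (rule transE)
  qed
  have four: "T w y z"
    if "x \<in> X" "y \<in> X" "z \<in> X" "w \<in> X" "T x y z" and xw: "(x, w) \<in> E_rel X T" for x y z w
  proof (rule ccontr)
    assume "\<not> T w y z"
    let ?v = "\<lambda>n. if n = 0 then {y} else X - {z}"
    have "sat X T S ?v w (Var 0 \<leadsto> Var 1)"
      using \<open>\<not> T w y z\<close> by auto
    \<comment> \<open>(A10) is used at \<open>w\<close>: symmetry leads from \<open>w\<close> back
      to \<open>x\<close>, where \<open>T x y z\<close> refutes the strict formula.\<close>
    then have "sat X T S ?v w (\<^bold>[\<^bold>\<forall>\<^bold>] (Var 0 \<leadsto> Var 1))"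
      using valid[OF A10[of "Var 0" "Var 1"], of "{y}" "X - {z}" w] that
      by (simp del: sat.simps(9))
    then have "sat X T S ?v x (Var 0 \<leadsto> Var 1)"
      using symE[OF xw] box[OF \<open>w \<in> X\<close>] by blast
    then show False using that by auto
  qed
  have five: "\<exists>u\<in>X. T x w u \<and> S z u"
    if X: "x \<in> X" "y \<in> X" "z \<in> X" "w \<in> X" and "T x y z" "S y w" for x y z w
  proof (rule ccontr)
    assume n: "\<not> (\<exists>u\<in>X. T x w u \<and> S z u)"
    \<comment> \<open>This is the largest value of \<open>Var 0\<close> making
      \<open>Var 0 \<leadsto> Var 1\<close> true at \<open>x\<close> when \<open>Var 1\<close> fails
      only at \<open>w\<close>. An \<open>S\<close>-successor of \<open>z\<close> outside
      \<open>?P\<close> would be the required \<open>u\<close>, so \<open>Var 0\<close> is boxed at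
      \<open>z\<close>; (Add) then boxes \<open>Var 1\<close> at \<open>y\<close>, against
      \<open>S y w\<close>.\<close>
    let ?P = "{u\<in>X. \<not> T x u w}"
    let ?v = "\<lambda>n. if n = 0 then ?P else X - {w}"
    have "sat X T S ?v x (Var 0 \<leadsto> Var 1)"
      by auto
    then have *: "sat X T S ?v x ((\<^bold>\<box> (Var 0)) \<leadsto> (\<^bold>\<box> (Var 1)))"
      using valid[OF Add[of "Var 0" "Var 1"], of ?P "X - {w}" x] X
      by (simp del: sat.simps(9))
    have "sat X T S ?v z (\<^bold>\<box> (Var 0))"
      using n sym X by auto
    then have "sat X T S ?v y (\<^bold>\<box> (Var 1))"
      using * sym[OF X(1,2,3) \<open>T x y z\<close>] X unfolding sat.simps(9) by blast
    then show False using \<open>S y w\<close> X by auto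
  qed
  show ?thesis
    unfolding MS2IC_conditions_def
    apply (intro conjI ballI impI)
    subgoal by (rule refl)
    subgoal by (rule sym)
    subgoal by (rule equivE)
    subgoal by (elim conjE) (rule four)
    subgoal by (elim conjE) (rule five)
    done
qed

lemma MS2IC_frame_iff_conditions:
  assumes "kripke_frame X T S"
  shows "MS2IC_frame X T S \<longleftrightarrow> MS2IC_conditions X T S"
proof
  show "MS2IC_conditions X T S" if "MS2IC_frame X T S"
    using that by (rule MS2IC_frame_imp_conditions)
  show "MS2IC_frame X T S" if "MS2IC_conditions X T S"
    using assms soundness[OF that] unfolding MS2IC_frame_def valid_in_def by blast
qed

section \<open>Derived theorems\<close>

text \<open>The hypotheses make \<phi> equivalent to a disjunction with \<phi>' and \<psi> to a
  conjunction with \<psi>'. \<open>RE\<close> inserts these forms, and (A2) and (A3) split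
  them.\<close>

lemma MS2IC_Strict_mono:
  assumes "\<turnstile> \<phi>' \<^bold>\<rightarrow> \<phi>" and "\<turnstile> \<psi> \<^bold>\<rightarrow> \<psi>'"
  shows "\<turnstile> (\<phi> \<leadsto> \<psi>) \<^bold>\<rightarrow> (\<phi>' \<leadsto> \<psi>')"
proof -
  have MP2: "\<turnstile> c" if "\<turnstile> a" "\<turnstile> b" "tautology (a \<^bold>\<rightarrow> b \<^bold>\<rightarrow> c)" for a b c
    using that by (meson MP Taut)
  have "\<turnstile> \<phi> \<^bold>\<leftrightarrow> (\<phi>' \<^bold>\<or> \<phi>)"
    by (rule MP[OF Taut assms(1)]) (auto simp: tautology_def)
  moreover have "\<turnstile> \<psi> \<^bold>\<leftrightarrow> \<psi>"
    by (rule Taut) (simp add: tautology_def)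
  ultimately have "\<turnstile> (\<phi> \<leadsto> \<psi>) \<^bold>\<leftrightarrow> ((\<phi>' \<^bold>\<or> \<phi>) \<leadsto> \<psi>)"
    by (rule RE)
  then have 1: "\<turnstile> (\<phi> \<leadsto> \<psi>) \<^bold>\<rightarrow> (\<phi>' \<leadsto> \<psi>)"
    by (rule MP2[OF _ A2[of \<phi>' \<phi> \<psi>]]) (auto simp: tautology_def)
  have "\<turnstile> \<psi> \<^bold>\<leftrightarrow> (\<psi> \<^bold>\<and> \<psi>')"
    by (rule MP[OF Taut assms(2)]) (auto simp: tautology_def)
  moreover have "\<turnstile> \<phi>' \<^bold>\<leftrightarrow> \<phi>'"
    by (rule Taut) (simp add: tautology_def)
  ultimately have "\<turnstile> (\<phi>' \<leadsto> \<psi>) \<^bold>\<leftrightarrow> (\<phi>' \<leadsto> (\<psi> \<^bold>\<and> \<psi>'))"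
    using RE by blast
  then have 2: "\<turnstile> (\<phi>' \<leadsto> \<psi>) \<^bold>\<rightarrow> (\<phi>' \<leadsto> \<psi>')"
    by (rule MP2[OF _ A3[of \<phi>' \<psi> \<psi>']]) (auto simp: tautology_def)
  show ?thesis
    by (rule MP2[OF 1 2]) (auto simp: tautology_def)
qed

section \<open>Theories and maximal consistent sets\<close>

text \<open>These are the filters of the Lindenbaum algebra, the improper one included; closure
  under necessitation is not demanded.\<close>

definition theory_set :: "fm set \<Rightarrow> bool" where
  "theory_set F \<longleftrightarrow> (\<forall>\<phi>. (\<turnstile> \<phi>) \<longrightarrow> \<phi> \<in> F) \<and> (\<forall>\<phi> \<psi>. (\<phi> \<^bold>\<rightarrow> \<psi>) \<in> F \<longrightarrow> \<phi> \<in> F \<longrightarrow> \<psi> \<in> F)"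

text \<open>The ultrafilters: one direction of the equivalence is consistency, the other is
  maximality.\<close>

definition mcs :: "fm set \<Rightarrow> bool" where
  "mcs x \<longleftrightarrow> theory_set x \<and> (\<forall>\<phi>. (\<^bold>\<not> \<phi>) \<in> x \<longleftrightarrow> \<phi> \<notin> x)"

lemma theory_setI:
  assumes "\<And>\<phi>. \<turnstile> \<phi> \<Longrightarrow> \<phi> \<in> F" and "\<And>\<phi> \<psi>. (\<phi> \<^bold>\<rightarrow> \<psi>) \<in> F \<Longrightarrow> \<phi> \<in> F \<Longrightarrow> \<psi> \<in> F"
  shows "theory_set F"
  using assms unfolding theory_set_def by blast

lemma theory_set_theorems: "theory_set {\<chi>. \<turnstile> \<chi>}"
  by (rule theory_setI) (auto intro: MP)

lemma theory_set_MS2IC: "theory_set F \<Longrightarrow> \<turnstile> \<phi> \<Longrightarrow> \<phi> \<in> F"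
  by (simp add: theory_set_def)

lemma theory_set_MP: "theory_set F \<Longrightarrow> (\<phi> \<^bold>\<rightarrow> \<psi>) \<in> F \<Longrightarrow> \<phi> \<in> F \<Longrightarrow> \<psi> \<in> F"
  unfolding theory_set_def by blast

lemma theory_set_taut1:
  assumes "theory_set F" "\<phi> \<in> F" "tautology (\<phi> \<^bold>\<rightarrow> \<psi>)"
  shows "\<psi> \<in> F"
  using assms Taut theory_set_MP theory_set_MS2IC by blast

lemma theory_set_taut2:
  assumes "theory_set F" "\<phi> \<in> F" "\<psi> \<in> F" "tautology (\<phi> \<^bold>\<rightarrow> \<psi> \<^bold>\<rightarrow> \<chi>)"
  shows "\<chi> \<in> F"
  using assms Taut theory_set_MP theory_set_MS2IC by blast

text \<open>By the deduction theorem this is the theory generated by \<open>F\<close> and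
  \<theta>.\<close>

lemma theory_set_adjoin:
  assumes F: "theory_set F"
  shows "theory_set {\<chi>. (\<theta> \<^bold>\<rightarrow> \<chi>) \<in> F}"
proof (rule theory_setI)
  show "\<phi> \<in> {\<chi>. (\<theta> \<^bold>\<rightarrow> \<chi>) \<in> F}" if "\<turnstile> \<phi>" for \<phi>
    using theory_set_taut1[OF F theory_set_MS2IC[OF F that]] by (simp add: tautology_def)
  show "\<psi> \<in> {\<chi>. (\<theta> \<^bold>\<rightarrow> \<chi>) \<in> F}"
    if "(\<phi> \<^bold>\<rightarrow> \<psi>) \<in> {\<chi>. (\<theta> \<^bold>\<rightarrow> \<chi>) \<in> F}" "\<phi> \<in> {\<chi>. (\<theta> \<^bold>\<rightarrow> \<chi>) \<in> F}" for \<phi> \<psi>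
    using that theory_set_taut2[OF F, of "\<theta> \<^bold>\<rightarrow> \<phi> \<^bold>\<rightarrow> \<psi>" "\<theta> \<^bold>\<rightarrow> \<phi>" "\<theta> \<^bold>\<rightarrow> \<psi>"]
    by (simp add: tautology_def)
qed

text \<open>An implication and its antecedent lie in a common member of the chain. \<open>P\<close>
  is arbitrary so that the chain can carry the side conditions of the Zorn argument.\<close>

lemma theory_set_Union_chain:
  assumes "C \<noteq> {}" "subset.chain {F. theory_set F \<and> P F} C"
  shows "theory_set (\<Union>C)"
proof (rule theory_setI)
  have th: "theory_set F" if "F \<in> C" for F
    using assms(2) that by (auto simp: subset.chain_def)
  show "\<phi> \<in> \<Union>C" if "\<turnstile> \<phi>" for \<phi>
    using assms(1) th that theory_set_MS2IC by blast
  fix \<phi> \<psi> assume "(\<phi> \<^bold>\<rightarrow> \<psi>) \<in> \<Union>C" "\<phi> \<in> \<Union>C"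
  then obtain F G where FG: "F \<in> C" "G \<in> C" "(\<phi> \<^bold>\<rightarrow> \<psi>) \<in> F" "\<phi> \<in> G" by blast
  moreover have "F \<subseteq> G \<or> G \<subseteq> F"
    using assms(2) FG(1,2) unfolding subset_chain_def by blast
  ultimately show "\<psi> \<in> \<Union>C"
    using th theory_set_MP by (metis Union_iff subsetD)
qed

text \<open>Zorn's lemma gives a theory maximal among those that extend \<open>F\<close> and omit
  \<phi>. Adjoining any missing \<theta> must produce \<phi>, so \<theta> and its negation cannot
  both be missing.\<close>

lemma lindenbaum:
  assumes F: "theory_set F" "\<phi> \<notin> F"
  obtains x where "mcs x" "F \<subseteq> x" "\<phi> \<notin> x"
proof -
  let ?A = "{G. theory_set G \<and> F \<subseteq> G \<and> \<phi> \<notin> G}"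
  have "\<exists>M\<in>?A. \<forall>X\<in>?A. M \<subseteq> X \<longrightarrow> X = M"
  proof (rule subset_Zorn_nonempty)
    show "?A \<noteq> {}" using F by blast
    fix C assume C: "C \<noteq> {}" "subset.chain ?A C"
    have "theory_set (\<Union>C)" by (rule theory_set_Union_chain[OF C])
    moreover have "C \<subseteq> ?A" using C(2) by (simp add: subset.chain_def)
    ultimately show "\<Union>C \<in> ?A" using C(1) by blast
  qed
  then obtain x where x: "theory_set x" "F \<subseteq> x" "\<phi> \<notin> x"
    and max: "\<And>G. theory_set G \<Longrightarrow> x \<subseteq> G \<Longrightarrow> \<phi> \<notin> G \<Longrightarrow> G = x"
    by (auto 0 3)
  have adjoin: "(\<theta> \<^bold>\<rightarrow> \<phi>) \<in> x" if "\<theta> \<notin> x" for \<theta>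
  proof (rule ccontr)
    assume n: "(\<theta> \<^bold>\<rightarrow> \<phi>) \<notin> x"
    let ?G = "{\<chi>. (\<theta> \<^bold>\<rightarrow> \<chi>) \<in> x}"
    have "x \<subseteq> ?G"
      using theory_set_taut1[OF x(1)] by (auto simp: tautology_def)
    then have "?G = x"
      using max[OF theory_set_adjoin[OF x(1)]] n by blast
    moreover have "\<theta> \<in> ?G"
      using theory_set_MS2IC[OF x(1) Taut] by (simp add: tautology_def)
    ultimately show False using that by blast
  qed
  have "(\<^bold>\<not> \<theta>) \<in> x \<longleftrightarrow> \<theta> \<notin> x" for \<theta>
  proof
    assume "(\<^bold>\<not> \<theta>) \<in> x"
    then show "\<theta> \<notin> x"
      using theory_set_taut2[OF x(1), of "\<^bold>\<not> \<theta>" \<theta> \<phi>] x(3) by (auto simp: tautology_def)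
  next
    assume "\<theta> \<notin> x"
    then have "(\<theta> \<^bold>\<rightarrow> \<phi>) \<in> x" by (rule adjoin)
    then show "(\<^bold>\<not> \<theta>) \<in> x"
      using theory_set_taut2[OF x(1), of "\<theta> \<^bold>\<rightarrow> \<phi>" "(\<^bold>\<not> \<theta>) \<^bold>\<rightarrow> \<phi>" \<phi>] adjoin[of "\<^bold>\<not> \<theta>"] x(3)
      by (auto simp: tautology_def)
  qed
  then show thesis using that x by (auto simp: mcs_def)
qed

section \<open>Connectives and strict implication in maximal consistent sets\<close>

lemma mcs_theory_set: "mcs x \<Longrightarrow> theory_set x"
  by (simp add: mcs_def)

lemma mcs_Neg: "mcs x \<Longrightarrow> (\<^bold>\<not> \<phi>) \<in> x \<longleftrightarrow> \<phi> \<notin> x"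
  by (simp add: mcs_def)

lemma mcs_Top: "mcs x \<Longrightarrow> \<^bold>\<top> \<in> x"
  using theory_set_MS2IC[OF mcs_theory_set Taut] by (simp add: tautology_def)

lemma mcs_Bot: "mcs x \<Longrightarrow> \<^bold>\<bottom> \<notin> x"
  using theory_set_MS2IC[OF mcs_theory_set Taut, of x "\<^bold>\<not> \<^bold>\<bottom>"] mcs_Neg
  by (auto simp: tautology_def)

lemma mcs_Imp:
  assumes "mcs x"
  shows "(\<phi> \<^bold>\<rightarrow> \<psi>) \<in> x \<longleftrightarrow> (\<phi> \<in> x \<longrightarrow> \<psi> \<in> x)"
proof -
  have "tautology ((\<^bold>\<not> \<phi>) \<^bold>\<rightarrow> (\<phi> \<^bold>\<rightarrow> \<psi>))" "tautology (\<psi> \<^bold>\<rightarrow> (\<phi> \<^bold>\<rightarrow> \<psi>))"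
    by (simp_all add: tautology_def)
  then show ?thesis
    using mcs_theory_set[OF assms] mcs_Neg[OF assms] theory_set_MP theory_set_taut1 by meson
qed

lemma mcs_Con:
  assumes "mcs x"
  shows "(\<phi> \<^bold>\<and> \<psi>) \<in> x \<longleftrightarrow> \<phi> \<in> x \<and> \<psi> \<in> x"
proof -
  have "tautology ((\<phi> \<^bold>\<and> \<psi>) \<^bold>\<rightarrow> \<phi>)" "tautology ((\<phi> \<^bold>\<and> \<psi>) \<^bold>\<rightarrow> \<psi>)"
    "tautology (\<phi> \<^bold>\<rightarrow> \<psi> \<^bold>\<rightarrow> (\<phi> \<^bold>\<and> \<psi>))"
    by (simp_all add: tautology_def)
  then show ?thesis
    using mcs_theory_set[OF assms] theory_set_taut1 theory_set_taut2 by meson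
qed

lemma mcs_tautology_iff:
  assumes "mcs x" "tautology (\<phi> \<^bold>\<leftrightarrow> \<psi>)"
  shows "\<phi> \<in> x \<longleftrightarrow> \<psi> \<in> x"
proof -
  have "tautology (\<phi> \<^bold>\<rightarrow> \<psi>)" "tautology (\<psi> \<^bold>\<rightarrow> \<phi>)"
    using assms(2) by (simp_all add: tautology_def)
  then show ?thesis
    using theory_set_taut1[OF mcs_theory_set[OF assms(1)]] by blast
qed

lemma mcs_Dis: "mcs x \<Longrightarrow> (\<phi> \<^bold>\<or> \<psi>) \<in> x \<longleftrightarrow> \<phi> \<in> x \<or> \<psi> \<in> x"
  using mcs_tautology_iff[of x "\<phi> \<^bold>\<or> \<psi>" "(\<^bold>\<not> \<phi>) \<^bold>\<rightarrow> \<psi>"]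
  by (auto simp: tautology_def mcs_Imp mcs_Neg)

lemma mcs_Iff: "mcs x \<Longrightarrow> (\<phi> \<^bold>\<leftrightarrow> \<psi>) \<in> x \<longleftrightarrow> (\<phi> \<in> x \<longleftrightarrow> \<psi> \<in> x)"
  using mcs_tautology_iff[of x "\<phi> \<^bold>\<leftrightarrow> \<psi>" "(\<phi> \<^bold>\<rightarrow> \<psi>) \<^bold>\<and> (\<psi> \<^bold>\<rightarrow> \<phi>)"]
  by (auto simp: tautology_def mcs_Imp mcs_Con)

lemmas mcs_connectives = mcs_Neg mcs_Top mcs_Bot mcs_Imp mcs_Con mcs_Dis mcs_Iff

lemma mcs_MS2IC: "mcs x \<Longrightarrow> \<turnstile> \<phi> \<Longrightarrow> \<phi> \<in> x"
  by (simp add: mcs_theory_set theory_set_MS2IC)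

lemma mcs_Strict_mono:
  assumes "mcs x" "(\<phi> \<leadsto> \<psi>) \<in> x" "tautology (\<phi>' \<^bold>\<rightarrow> \<phi>)" "tautology (\<psi> \<^bold>\<rightarrow> \<psi>')"
  shows "(\<phi>' \<leadsto> \<psi>') \<in> x"
  using mcs_MS2IC[OF assms(1) MS2IC_Strict_mono[OF Taut Taut]] assms by (simp add: mcs_Imp)

lemma mcs_Strict_Con:
  assumes x: "mcs x" and "(\<phi> \<leadsto> \<psi>) \<in> x" "(\<phi>' \<leadsto> \<psi>') \<in> x"
  shows "((\<phi> \<^bold>\<and> \<phi>') \<leadsto> (\<psi> \<^bold>\<and> \<psi>')) \<in> x"
proof -
  have "((\<phi> \<^bold>\<and> \<phi>') \<leadsto> \<psi>) \<in> x" "((\<phi> \<^bold>\<and> \<phi>') \<leadsto> \<psi>') \<in> x"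
    using assms by (auto intro: mcs_Strict_mono simp: tautology_def)
  then show ?thesis
    using mcs_MS2IC[OF x A3] x by (simp add: mcs_connectives)
qed

lemma mcs_Strict_Dis:
  assumes x: "mcs x" and "(\<phi> \<leadsto> \<chi>) \<in> x" "(\<psi> \<leadsto> \<chi>) \<in> x"
  shows "((\<phi> \<^bold>\<or> \<psi>) \<leadsto> \<chi>) \<in> x"
  using assms mcs_MS2IC[OF x A2] by (simp add: mcs_connectives)

section \<open>The canonical frame\<close>

definition canT :: "fm set \<Rightarrow> fm set \<Rightarrow> fm set \<Rightarrow> bool" where
  "canT x y z \<longleftrightarrow> mcs x \<and> mcs y \<and> mcs z \<and> (\<forall>\<phi> \<psi>. (\<phi> \<leadsto> \<psi>) \<in> x \<longrightarrow> \<phi> \<in> y \<longrightarrow> \<psi> \<in> z)"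

definition canS :: "fm set \<Rightarrow> fm set \<Rightarrow> bool" where
  "canS x y \<longleftrightarrow> mcs x \<and> mcs y \<and> (\<forall>\<phi>. (\<^bold>\<box> \<phi>) \<in> x \<longrightarrow> \<phi> \<in> y)"

lemma canT_refl: "mcs x \<Longrightarrow> canT x x x"
  using mcs_MS2IC[OF _ A4] by (auto simp: canT_def mcs_Imp)

lemma canT_sym:
  assumes T: "canT x y z"
  shows "canT x z y"
proof -
  have m: "mcs x" "mcs y" "mcs z" using T by (auto simp: canT_def)
  have "\<psi> \<in> y" if "(\<phi> \<leadsto> \<psi>) \<in> x" "\<phi> \<in> z" for \<phi> \<psi>
  proof (rule ccontr)
    assume "\<psi> \<notin> y"
    then have "(\<^bold>\<not> \<psi>) \<in> y" using m by (simp add: mcs_Neg)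
    moreover have "((\<^bold>\<not> \<psi>) \<leadsto> (\<^bold>\<not> \<phi>)) \<in> x"
      using mcs_MS2IC[OF m(1) A5[of \<phi> \<psi>]] that m by (simp add: mcs_Iff)
    ultimately have "(\<^bold>\<not> \<phi>) \<in> z" using T unfolding canT_def by blast
    then show False using that m by (simp add: mcs_Neg)
  qed
  then show ?thesis using m by (simp add: canT_def)
qed

text \<open>By \<open>canT_sym\<close> and \<open>Top\<close> in \<open>z\<close>, whatever is
  universal in \<open>x\<close> lies in \<open>y\<close>. (A10) makes a strict formula in
  \<open>x\<close> universal, and (A9) does the same for the negation of one missing from
  \<open>x\<close>.\<close>

lemma canT_same_Strict:
  assumes T: "canT x y z"
  shows "(\<phi> \<leadsto> \<psi>) \<in> y \<longleftrightarrow> (\<phi> \<leadsto> \<psi>) \<in> x"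
proof -
  have m: "mcs x" "mcs y" "mcs z" using T by (auto simp: canT_def)
  have U: "\<chi> \<in> y" if "(\<^bold>[\<^bold>\<forall>\<^bold>] \<chi>) \<in> x" for \<chi>
    using canT_sym[OF T] that mcs_Top[OF m(3)] unfolding canT_def by blast
  have *: "(\<phi> \<leadsto> \<psi>) \<in> w \<longleftrightarrow> (\<^bold>[\<^bold>\<forall>\<^bold>] (\<phi> \<leadsto> \<psi>)) \<in> w" if "mcs w" for w
    using mcs_MS2IC[OF that A10[of \<phi> \<psi>]] that by (simp add: mcs_Iff)
  show ?thesis
  proof
    show "(\<phi> \<leadsto> \<psi>) \<in> y" if "(\<phi> \<leadsto> \<psi>) \<in> x"
      using that U *[OF m(1)] by blast
    show "(\<phi> \<leadsto> \<psi>) \<in> x" if "(\<phi> \<leadsto> \<psi>) \<in> y"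
    proof (rule ccontr)
      assume "(\<phi> \<leadsto> \<psi>) \<notin> x"
      then have "(\<^bold>[\<^bold>\<forall>\<^bold>] (\<^bold>\<not> (\<^bold>[\<^bold>\<forall>\<^bold>] (\<phi> \<leadsto> \<psi>)))) \<in> x"
        using mcs_MS2IC[OF m(1) A9[of "\<phi> \<leadsto> \<psi>"]] *[OF m(1)] m by (simp add: mcs_connectives)
      then have "(\<^bold>\<not> (\<^bold>[\<^bold>\<forall>\<^bold>] (\<phi> \<leadsto> \<psi>))) \<in> y" by (rule U)
      then show False using that *[OF m(2)] m by (simp add: mcs_Neg)
    qed
  qed
qed

text \<open>Apart from being maximal consistent, the first argument of \<open>canT\<close> matters
  only through its strict formulas, so agreement on these gives an equation between functions, ready
  for rewriting.\<close>

lemma canT_eq: "canT x y z \<Longrightarrow> canT y = canT x"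
  using canT_same_Strict[of x y z] by (auto simp: canT_def fun_eq_iff)

text \<open>This is the theory generated by \<open>L\<close> and the consequents that
  \<open>x\<close> forces from \<open>y\<close>. Single witnesses \<theta> and \<alpha> suffice
  because \<open>y\<close> and \<open>L\<close> are closed under conjunction.\<close>

lemma theory_set_Strict_image:
  assumes x: "mcs x" and y: "mcs y"
    and L: "theory_set L"
  shows "theory_set {\<chi>. \<exists>\<theta>\<in>y. \<exists>\<alpha>\<in>L. (\<theta> \<leadsto> (\<alpha> \<^bold>\<rightarrow> \<chi>)) \<in> x}" (is "theory_set ?F")
proof (rule theory_setI)
  fix \<phi> assume "\<turnstile> \<phi>"
  have "\<turnstile> \<phi> \<^bold>\<rightarrow> (\<phi> \<^bold>\<rightarrow> \<phi>)" by (rule Taut) (simp add: tautology_def)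
  then have "(\<^bold>\<top> \<leadsto> (\<phi> \<^bold>\<rightarrow> \<phi>)) \<in> x"
    using \<open>\<turnstile> \<phi>\<close> by (meson MP N_Univ mcs_MS2IC x)
  then show "\<phi> \<in> ?F"
    using mcs_Top[OF y] theory_set_MS2IC[OF L \<open>\<turnstile> \<phi>\<close>] by blast
next
  fix \<phi> \<psi> assume "(\<phi> \<^bold>\<rightarrow> \<psi>) \<in> ?F" "\<phi> \<in> ?F"
  then obtain \<theta> \<alpha> \<theta>' \<alpha>' where
    1: "\<theta> \<in> y" "\<alpha> \<in> L" "(\<theta> \<leadsto> (\<alpha> \<^bold>\<rightarrow> \<phi> \<^bold>\<rightarrow> \<psi>)) \<in> x" and
    2: "\<theta>' \<in> y" "\<alpha>' \<in> L" "(\<theta>' \<leadsto> (\<alpha>' \<^bold>\<rightarrow> \<phi>)) \<in> x" by blast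
  have "(\<theta> \<^bold>\<and> \<theta>') \<in> y" using 1 2 y by (simp add: mcs_Con)
  moreover have "(\<alpha> \<^bold>\<and> \<alpha>') \<in> L"
    by (rule theory_set_taut2[OF L 1(2) 2(2)]) (simp add: tautology_def)
  moreover have "((\<theta> \<^bold>\<and> \<theta>') \<leadsto> ((\<alpha> \<^bold>\<and> \<alpha>') \<^bold>\<rightarrow> \<psi>)) \<in> x"
    by (rule mcs_Strict_mono[OF x mcs_Strict_Con[OF x 1(3) 2(3)]]) (auto simp: tautology_def)
  ultimately show "\<psi> \<in> ?F" by blast
qed

text \<open>
  Both the truth lemma for \<open>\<leadsto>\<close> (with \<open>L\<close> the set of theorems) and condition (5) (with \<open>L\<close> the
  formulas boxed in a point) need a third point \<open>z\<close>.
\<close>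

lemma canT_extend:
  assumes x: "mcs x" and y: "mcs y" and L: "theory_set L"
    and avoid: "\<And>\<theta> \<alpha>. \<theta> \<in> y \<Longrightarrow> \<alpha> \<in> L \<Longrightarrow> (\<theta> \<leadsto> (\<alpha> \<^bold>\<rightarrow> \<psi>)) \<notin> x"
  obtains z where "canT x y z" "L \<subseteq> z" "\<psi> \<notin> z"
proof -
  let ?F = "{\<chi>. \<exists>\<theta>\<in>y. \<exists>\<alpha>\<in>L. (\<theta> \<leadsto> (\<alpha> \<^bold>\<rightarrow> \<chi>)) \<in> x}"
  have "\<psi> \<notin> ?F" using avoid by blast
  then obtain z where z: "mcs z" "?F \<subseteq> z" "\<psi> \<notin> z"
    using lindenbaum[OF theory_set_Strict_image[OF x y L]] by blast
  have Top: "\<^bold>\<top> \<in> L"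
    by (rule theory_set_MS2IC[OF L Taut]) (simp add: tautology_def)
  \<comment> \<open>Forced consequents enter \<open>?F\<close> with \<alpha> equal to
    \<open>Top\<close>; elements of \<open>L\<close> enter it with \<theta> equal to
    \<open>Top\<close>.\<close>
  have "\<beta> \<in> z" if "(\<phi> \<leadsto> \<beta>) \<in> x" "\<phi> \<in> y" for \<phi> \<beta>
  proof -
    have "(\<phi> \<leadsto> (\<^bold>\<top> \<^bold>\<rightarrow> \<beta>)) \<in> x"
      by (rule mcs_Strict_mono[OF x that(1)]) (simp_all add: tautology_def)
    then show ?thesis using that Top z(2) by blast
  qed
  moreover have "\<alpha> \<in> z" if "\<alpha> \<in> L" for \<alpha>
  proof -
    have "\<turnstile> \<^bold>\<top> \<leadsto> (\<alpha> \<^bold>\<rightarrow> \<alpha>)"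
      by (rule N_Univ[OF Taut]) (simp add: tautology_def)
    then show ?thesis using mcs_MS2IC[OF x] mcs_Top[OF y] that z(2) by blast
  qed
  ultimately have "canT x y z" "L \<subseteq> z"
    using x y z(1) unfolding canT_def by blast+
  then show thesis using that z(3) by blast
qed

lemma theory_set_unbox:
  assumes x: "mcs x"
  shows "theory_set {\<chi>. (\<^bold>\<box> \<chi>) \<in> x}"
proof (rule theory_setI)
  show "\<phi> \<in> {\<chi>. (\<^bold>\<box> \<chi>) \<in> x}" if "\<turnstile> \<phi>" for \<phi>
    using mcs_MS2IC[OF x N_Box[OF that]] by simp
  show "\<psi> \<in> {\<chi>. (\<^bold>\<box> \<chi>) \<in> x}"
    if "(\<phi> \<^bold>\<rightarrow> \<psi>) \<in> {\<chi>. (\<^bold>\<box> \<chi>) \<in> x}" "\<phi> \<in> {\<chi>. (\<^bold>\<box> \<chi>) \<in> x}" for \<phi> \<psi>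
    using mcs_MS2IC[OF x K[of \<phi> \<psi>]] that x by (simp add: mcs_Imp)
qed

text \<open>The point \<open>u\<close> must contain all formulas boxed in \<open>z\<close>. An
  obstruction would be a strict implication in \<open>x\<close> from some \<theta> in
  \<open>w\<close> to the negation of such an \<alpha>; contraposing it by (A5) and boxing it by
  (Add) puts the boxed negation of \<theta> into \<open>y\<close>, against
  \<open>canS y w\<close>.\<close>

lemma canT_canS_back:
  assumes T: "canT x y z" and S: "canS y w"
  shows "\<exists>u. canT x w u \<and> canS z u"
proof -
  have m: "mcs x" "mcs y" "mcs z" "mcs w" using T S by (auto simp: canT_def canS_def)
  \<comment> \<open>\<open>Bot\<close> as the omitted formula expresses mere consistency of
    \<open>u\<close>.\<close>
  have avoid: "(\<theta> \<leadsto> (\<alpha> \<^bold>\<rightarrow> \<^bold>\<bottom>)) \<notin> x" if "\<theta> \<in> w" "\<alpha> \<in> {\<chi>. (\<^bold>\<box> \<chi>) \<in> z}" for \<theta> \<alpha>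
  proof
    assume "(\<theta> \<leadsto> (\<alpha> \<^bold>\<rightarrow> \<^bold>\<bottom>)) \<in> x"
    then have "((\<^bold>\<not> (\<alpha> \<^bold>\<rightarrow> \<^bold>\<bottom>)) \<leadsto> (\<^bold>\<not> \<theta>)) \<in> x"
      using mcs_MS2IC[OF m(1) A5[of \<theta> "\<alpha> \<^bold>\<rightarrow> \<^bold>\<bottom>"]] m by (simp add: mcs_Iff)
    then have "(\<alpha> \<leadsto> (\<^bold>\<not> \<theta>)) \<in> x"
      by (rule mcs_Strict_mono[OF m(1)]) (simp_all add: tautology_def)
    then have "((\<^bold>\<box> \<alpha>) \<leadsto> (\<^bold>\<box> (\<^bold>\<not> \<theta>))) \<in> x"
      using mcs_MS2IC[OF m(1) Add[of \<alpha> "\<^bold>\<not> \<theta>"]] m by (simp add: mcs_Imp)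
    then have "(\<^bold>\<box> (\<^bold>\<not> \<theta>)) \<in> y"
      using canT_sym[OF T] that(2) unfolding canT_def by blast
    then have "(\<^bold>\<not> \<theta>) \<in> w" using S by (simp add: canS_def)
    then show False using that(1) m by (simp add: mcs_Neg)
  qed
  obtain u where "canT x w u" "{\<chi>. (\<^bold>\<box> \<chi>) \<in> z} \<subseteq> u"
    using canT_extend[OF m(1,4) theory_set_unbox[OF m(3)] avoid] by blast
  then show ?thesis using m by (auto simp: canS_def canT_def)
qed

lemma canonical_kripke_frame: "kripke_frame {x. mcs x} canT canS"
  by (auto simp: kripke_frame_def canT_def canS_def)

lemma canonical_conditions: "MS2IC_conditions {x. mcs x} canT canS"
proof -
  have E: "(x, y) \<in> E_rel {x. mcs x} canT \<longleftrightarrow> (\<exists>z. canT x y z)" for x y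
    by (auto simp: E_rel_def canT_def)
  have equivE: "equiv {x. mcs x} (E_rel {x. mcs x} canT)"
  proof (rule equivI)
    show "E_rel {x. mcs x} canT \<subseteq> {x. mcs x} \<times> {x. mcs x}"
      by (auto simp: E_rel_def)
    show "refl_on {x. mcs x} (E_rel {x. mcs x} canT)"
      using canT_refl by (auto simp: refl_on_def E)
    show "sym_on UNIV (E_rel {x. mcs x} canT)"
    proof (rule symI)
      fix x y assume "(x, y) \<in> E_rel {x. mcs x} canT"
      then obtain z where z: "canT x y z" by (auto simp: E)
      \<comment> \<open>Reflexivity at \<open>x\<close>, rewritten by
        \<open>canT y = canT x\<close>, makes \<open>x\<close> a successor of
        \<open>y\<close>.\<close>
      then have "canT y x x" using canT_eq[OF z] canT_refl by (simp add: canT_def)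
      then show "(y, x) \<in> E_rel {x. mcs x} canT" by (auto simp: E)
    qed
    show "trans_on UNIV (E_rel {x. mcs x} canT)"
      by (rule transI) (metis E canT_eq)
  qed
  have four: "canT w y z" if "canT x y z" "(x, w) \<in> E_rel {x. mcs x} canT" for x y z w
    using that by (metis E canT_eq)
  have five: "\<exists>u\<in>{x. mcs x}. canT x w u \<and> canS z u" if "canT x y z" "canS y w" for x y z w
    using canT_canS_back[OF that] by (auto simp: canS_def)
  show ?thesis
    unfolding MS2IC_conditions_def
    apply (intro conjI ballI impI)
    subgoal by (simp add: canT_refl)
    subgoal by (rule canT_sym)
    subgoal by (rule equivE)
    subgoal by (elim conjE) (rule four)
    subgoal by (elim conjE) (rule five)
    done
qed

text \<open>The point \<open>y\<close> is chosen first, so that it contains \<phi> and no \<theta>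
  with \<theta> \<leadsto> \<psi> in \<open>x\<close>; \<open>canT_extend\<close> then supplies
  \<open>z\<close>.\<close>

lemma canonical_Strict:
  assumes x: "mcs x" and n: "(\<phi> \<leadsto> \<psi>) \<notin> x"
  shows "\<exists>y z. canT x y z \<and> \<phi> \<in> y \<and> \<psi> \<notin> z"
proof -
  \<comment> \<open>The formulas that \<open>y\<close> is obliged to contain: with the negation of
    such a \<theta> beside \<phi>, every \<open>z\<close> would be forced to contain \<psi>.\<close>
  let ?F = "{\<theta>. ((\<phi> \<^bold>\<and> (\<^bold>\<not> \<theta>)) \<leadsto> \<psi>) \<in> x}"
  have F: "theory_set ?F"
  proof (rule theory_setI)
    fix \<theta> assume "\<turnstile> \<theta>"
    have "\<turnstile> \<theta> \<^bold>\<rightarrow> ((\<phi> \<^bold>\<and> (\<^bold>\<not> \<theta>)) \<^bold>\<rightarrow> \<^bold>\<bottom>)" "\<turnstile> \<psi> \<^bold>\<rightarrow> \<psi>"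
      by (rule Taut, simp add: tautology_def)+
    then have "\<turnstile> (\<^bold>\<bottom> \<leadsto> \<psi>) \<^bold>\<rightarrow> ((\<phi> \<^bold>\<and> (\<^bold>\<not> \<theta>)) \<leadsto> \<psi>)"
      using MP[OF _ \<open>\<turnstile> \<theta>\<close>] MS2IC_Strict_mono by blast
    then have "((\<^bold>\<bottom> \<leadsto> \<psi>) \<^bold>\<rightarrow> ((\<phi> \<^bold>\<and> (\<^bold>\<not> \<theta>)) \<leadsto> \<psi>)) \<in> x"
      by (rule mcs_MS2IC[OF x])
    then show "\<theta> \<in> ?F"
      using mcs_MS2IC[OF x A1[of \<psi>]] x by (simp add: mcs_connectives)
  next
    fix \<theta> \<chi> assume "(\<theta> \<^bold>\<rightarrow> \<chi>) \<in> ?F" "\<theta> \<in> ?F"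
    \<comment> \<open>A case split on \<theta> shows that \<phi> without \<chi> entails one of the
      two disjuncts, so monotonicity finishes.\<close>
    then have "(((\<phi> \<^bold>\<and> (\<^bold>\<not> (\<theta> \<^bold>\<rightarrow> \<chi>))) \<^bold>\<or> (\<phi> \<^bold>\<and> (\<^bold>\<not> \<theta>))) \<leadsto> \<psi>) \<in> x"
      using mcs_Strict_Dis[OF x] by blast
    then have "((\<phi> \<^bold>\<and> (\<^bold>\<not> \<chi>)) \<leadsto> \<psi>) \<in> x"
      by (rule mcs_Strict_mono[OF x]) (auto simp: tautology_def)
    then show "\<chi> \<in> ?F" by simp
  qed
  have "\<^bold>\<bottom> \<notin> ?F"
  proof
    assume "\<^bold>\<bottom> \<in> ?F"
    then have "(\<phi> \<leadsto> \<psi>) \<in> x"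
      by (auto intro: mcs_Strict_mono[OF x] simp: tautology_def)
    then show False using n by blast
  qed
  then obtain y where y: "mcs y" "?F \<subseteq> y" using lindenbaum[OF F] by blast
  have "((\<phi> \<^bold>\<and> (\<^bold>\<not> \<phi>)) \<leadsto> \<psi>) \<in> x"
    using mcs_MS2IC[OF x A1[of \<psi>]] x
    by (auto intro: mcs_Strict_mono[OF x, of "\<^bold>\<bottom>" \<psi>] simp: tautology_def mcs_Con)
  then have "\<phi> \<in> y" using y(2) by blast
  have avoid: "(\<theta> \<leadsto> (\<alpha> \<^bold>\<rightarrow> \<psi>)) \<notin> x" if "\<theta> \<in> y" "\<alpha> \<in> {\<chi>. \<turnstile> \<chi>}" for \<theta> \<alpha>
  proof
    assume *: "(\<theta> \<leadsto> (\<alpha> \<^bold>\<rightarrow> \<psi>)) \<in> x"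
    \<comment> \<open>As \<alpha> is a theorem, it can be discharged from the consequent. The double
      negation gives the antecedent the shape that \<open>?F\<close> requires, which puts the
      negation of \<theta> into \<open>y\<close>.\<close>
    have "\<turnstile> \<alpha> \<^bold>\<rightarrow> ((\<alpha> \<^bold>\<rightarrow> \<psi>) \<^bold>\<rightarrow> \<psi>)" "\<turnstile> (\<phi> \<^bold>\<and> (\<^bold>\<not> (\<^bold>\<not> \<theta>))) \<^bold>\<rightarrow> \<theta>"
      by (rule Taut, simp add: tautology_def)+
    then have "\<turnstile> (\<theta> \<leadsto> (\<alpha> \<^bold>\<rightarrow> \<psi>)) \<^bold>\<rightarrow> ((\<phi> \<^bold>\<and> (\<^bold>\<not> (\<^bold>\<not> \<theta>))) \<leadsto> \<psi>)"
      using that(2) MP MS2IC_Strict_mono by blast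
    then have "((\<theta> \<leadsto> (\<alpha> \<^bold>\<rightarrow> \<psi>)) \<^bold>\<rightarrow> ((\<phi> \<^bold>\<and> (\<^bold>\<not> (\<^bold>\<not> \<theta>))) \<leadsto> \<psi>)) \<in> x"
      by (rule mcs_MS2IC[OF x])
    then have "(\<^bold>\<not> \<theta>) \<in> y"
      using * x y(2) by (auto simp: mcs_Imp)
    then show False using that(1) y(1) by (simp add: mcs_Neg)
  qed
  obtain z where "canT x y z" "\<psi> \<notin> z"
    using canT_extend[OF x y(1) theory_set_theorems avoid] by blast
  then show ?thesis using \<open>\<phi> \<in> y\<close> by blast
qed

lemma canonical_Box:
  assumes "mcs x" "(\<^bold>\<box> \<phi>) \<notin> x"
  shows "\<exists>y. canS x y \<and> \<phi> \<notin> y"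
proof -
  obtain y where "mcs y" "{\<chi>. (\<^bold>\<box> \<chi>) \<in> x} \<subseteq> y" "\<phi> \<notin> y"
    using lindenbaum[OF theory_set_unbox[OF assms(1)]] assms(2) by blast
  then show ?thesis using assms(1) by (auto simp: canS_def)
qed

section \<open>Truth lemma and completeness\<close>

lemma truth_lemma:
  assumes "mcs x"
  shows "sat {x. mcs x} canT canS (\<lambda>p. {x. mcs x \<and> Var p \<in> x}) x \<phi> \<longleftrightarrow> \<phi> \<in> x"
  using assms
proof (induction \<phi> arbitrary: x)
  case (Strict \<phi> \<psi>)
  have "(\<phi> \<leadsto> \<psi>) \<in> x \<longleftrightarrow> (\<forall>y z. canT x y z \<and> \<phi> \<in> y \<longrightarrow> \<psi> \<in> z)"
    using canonical_Strict[OF Strict.prems] unfolding canT_def by blast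
  then show ?case using Strict.IH by (auto simp: canT_def)
next
  case (Box \<phi>)
  have "(\<^bold>\<box> \<phi>) \<in> x \<longleftrightarrow> (\<forall>y. canS x y \<longrightarrow> \<phi> \<in> y)"
    using canonical_Box[OF Box.prems] unfolding canS_def by blast
  then show ?case using Box.IH by (auto simp: canS_def)
qed (simp_all add: mcs_connectives)

text \<open>A non-theorem is omitted by some maximal consistent set and so fails there in the
  canonical frame, which is an \<open>MS2IC_frame\<close> by the correspondence and has its points
  in \<open>fm set\<close>.\<close>

lemma completeness:
  assumes "valid_in_all_frames TYPE(fm set) \<phi>"
  shows "\<turnstile> \<phi>"
proof (rule ccontr)
  assume "\<not> (\<turnstile> \<phi>)"
  then obtain x where x: "mcs x" "\<phi> \<notin> x"
    using lindenbaum[OF theory_set_theorems, of \<phi>] by blast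
  have "valid_in {x. mcs x} canT canS \<phi>"
    using assms canonical_conditions MS2IC_frame_iff_conditions[OF canonical_kripke_frame]
    unfolding valid_in_all_frames_def by blast
  then have "sat {x. mcs x} canT canS (\<lambda>p. {x. mcs x \<and> Var p \<in> x}) x \<phi>"
    unfolding valid_in_def
    by (elim allE[where x = "\<lambda>p. {x. mcs x \<and> Var p \<in> x}"] impE) (use x(1) in auto)
  then show False using truth_lemma x by blast
qed

lemma valid_in_all_frames_if_MS2IC: "\<turnstile> \<phi> \<Longrightarrow> valid_in_all_frames TYPE('w) \<phi>"
  by (simp add: valid_in_all_frames_def MS2IC_frame_def)

theorem theorem4p1:
  shows "(\<forall>(X :: 'w set) T S. kripke_frame X T S \<longrightarrow>
           (MS2IC_frame X T S \<longleftrightarrow>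
              (\<forall>x\<in>X. T x x x) \<and>
              (\<forall>x\<in>X. \<forall>y\<in>X. \<forall>z\<in>X. T x y z \<longrightarrow> T x z y) \<and>
              equiv X (E_rel X T) \<and>
              (\<forall>x\<in>X. \<forall>y\<in>X. \<forall>z\<in>X. \<forall>w\<in>X. T x y z \<and> (x, w) \<in> E_rel X T \<longrightarrow> T w y z) \<and>
              (\<forall>x\<in>X. \<forall>y\<in>X. \<forall>z\<in>X. \<forall>w\<in>X. T x y z \<and> S y w \<longrightarrow> (\<exists>u\<in>X. T x w u \<and> S z u))))
       \<and> (\<forall>\<phi>. (\<turnstile> \<phi>) \<longrightarrow> valid_in_all_frames TYPE('w) \<phi>)
       \<and> (\<forall>\<phi>. (\<turnstile> \<phi>) \<longleftrightarrow> valid_in_all_frames TYPE(fm set) \<phi>)"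
proof (intro conjI)
  show "\<forall>\<phi>. (\<turnstile> \<phi>) \<longrightarrow> valid_in_all_frames TYPE('w) \<phi>"
    using valid_in_all_frames_if_MS2IC by blast
  show "\<forall>\<phi>. (\<turnstile> \<phi>) \<longleftrightarrow> valid_in_all_frames TYPE(fm set) \<phi>"
    using completeness valid_in_all_frames_if_MS2IC by blast
qed (simp only: MS2IC_frame_iff_conditions MS2IC_conditions_def simp_thms cong: imp_cong)

end
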